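(* Every 2-local derivation on the mirror Heisenberg-Virasoro algebra $\mathfrak{D}$ is a derivation.
   Context: All vector spaces and algebras are over $\mathbb{C}$. The mirror Heisenberg-Virasoro algebra $\mathfrak{D}$ is the Lie algebra with $\mathbb{C}$-basis $\{d_m, h_r, \mathbf{c}, \mathbf{l} \mid m\in\mathbb{Z}, r\in\frac12+\mathbb{Z}\}$ and brackets $[d_m,d_n]=(m-n)d_{m+n}+\frac{m^3-m}{12}\delta_{m+n,0}\mathbf{c}$, $[d_m,h_r]=-r\,h_{m+r}$, $[h_r,h_s]=r\,\delta_{r+s,0}\mathbf{l}$, $[\mathbf{c},\mathfrak{D}]=[\mathbf{l},\mathfrak{D}]=0$ for $m,n\in\mathbb{Z}$, $r,s\in\frac12+\mathbb{Z}$, where $\delta$ is the Kronecker delta. A map $\Delta: L\to L$ on an algebra $L$ (linearity is not part of the definition) is called a 2-local derivation if for every $x,y\in L$ there exists a derivation $\Delta_{x,y}$ of $L$ such that $\Delta_{x,y}(x)=\Delta(x)$ and $\Delta_{x,y}(y)=\Delta(y)$. *)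

theory Defs
  imports Complex_Main "HOL-Library.Poly_Mapping"
begin

text \<open>An algebra over the complex numbers is given on a whole type by its scalar multiplication
  and its product. Note that \<^const>\<open>Vector_Spaces.linear\<close> includes the vector space axioms.\<close>

definition derivation ::
  "(complex \<Rightarrow> 'a \<Rightarrow> 'a) \<Rightarrow> ('a \<Rightarrow> 'a \<Rightarrow> 'a) \<Rightarrow> ('a::ab_group_add \<Rightarrow> 'a) \<Rightarrow> bool" where
  "derivation scl br \<delta> \<longleftrightarrow>
     Vector_Spaces.linear scl scl \<delta> \<and> (\<forall>x y. \<delta> (br x y) = br (\<delta> x) y + br x (\<delta> y))"

definition two_local_derivation ::
  "(complex \<Rightarrow> 'a \<Rightarrow> 'a) \<Rightarrow> ('a \<Rightarrow> 'a \<Rightarrow> 'a) \<Rightarrow> ('a::ab_group_add \<Rightarrow> 'a) \<Rightarrow> bool" where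
  "two_local_derivation scl br \<Delta> \<longleftrightarrow>
     (\<forall>x y. \<exists>\<delta>. derivation scl br \<delta> \<and> \<delta> x = \<Delta> x \<and> \<delta> y = \<Delta> y)"

text \<open>The half-integer \<open>k + 1/2\<close> is encoded by the integer \<open>k\<close>: the basis vector \<open>Hgen k\<close> stands for
  \<open>h\<^sub>r\<close> with \<open>r = k + 1/2\<close>. The other basis vectors are \<open>Dgen m\<close> for \<open>d\<^sub>m\<close> and the central
  \<open>Cgen\<close>, \<open>Lgen\<close>.\<close>

datatype mhv_basis = Dgen int | Hgen int | Cgen | Lgen

definition half_index :: "int \<Rightarrow> complex" where
  "half_index k = of_int k + 1 / 2"

text \<open>The underlying vector space is the space of finite formal linear combinations of the basis.\<close>

type_synonym mhv = "mhv_basis \<Rightarrow>\<^sub>0 complex"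

definition mhv_scale :: "complex \<Rightarrow> mhv \<Rightarrow> mhv" where
  "mhv_scale a x = Poly_Mapping.map ((*) a) x"

fun mhv_basis_bracket :: "mhv_basis \<Rightarrow> mhv_basis \<Rightarrow> mhv" where
  "mhv_basis_bracket (Dgen m) (Dgen n) =
     Poly_Mapping.single (Dgen (m + n)) (of_int (m - n))
     + (if m + n = 0 then Poly_Mapping.single Cgen (of_int (m ^ 3 - m) / 12) else 0)"
| "mhv_basis_bracket (Dgen m) (Hgen k) =
     Poly_Mapping.single (Hgen (m + k)) (- half_index k)"
| "mhv_basis_bracket (Hgen k) (Dgen m) =
     Poly_Mapping.single (Hgen (m + k)) (half_index k)"
| "mhv_basis_bracket (Hgen j) (Hgen k) =
     (if half_index j + half_index k = 0 then Poly_Mapping.single Lgen (half_index j) else 0)"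
| "mhv_basis_bracket _ _ = 0"

definition mhv_bracket :: "mhv \<Rightarrow> mhv \<Rightarrow> mhv" where
  "mhv_bracket x y =
     (\<Sum>a\<in>Poly_Mapping.keys x. \<Sum>b\<in>Poly_Mapping.keys y.
        mhv_scale (Poly_Mapping.lookup x a * Poly_Mapping.lookup y b) (mhv_basis_bracket a b))"

lemma lookup_mhv_scale [simp]:
  "Poly_Mapping.lookup (mhv_scale a x) b = a * Poly_Mapping.lookup x b"
  by (simp add: mhv_scale_def Poly_Mapping.map.rep_eq when_def)

interpretation mhv: vector_space mhv_scale
  by unfold_locales (auto intro!: poly_mapping_eqI simp: lookup_add algebra_simps)

lemma mhv_scale_single [simp]:
  "mhv_scale a (Poly_Mapping.single b c) = Poly_Mapping.single b (a * c)"
  by (rule poly_mapping_eqI) (simp add: lookup_single when_def)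

lemma mhv_bracket_superset:
  assumes "finite A" "finite B" "Poly_Mapping.keys x \<subseteq> A" "Poly_Mapping.keys y \<subseteq> B"
  shows "mhv_bracket x y = (\<Sum>a\<in>A. \<Sum>b\<in>B.
    mhv_scale (Poly_Mapping.lookup x a * Poly_Mapping.lookup y b) (mhv_basis_bracket a b))"
proof -
  have "mhv_bracket x y = (\<Sum>a\<in>Poly_Mapping.keys x. \<Sum>b\<in>B.
      mhv_scale (Poly_Mapping.lookup x a * Poly_Mapping.lookup y b) (mhv_basis_bracket a b))"
    unfolding mhv_bracket_def using assms
    by (intro sum.cong refl sum.mono_neutral_left) (auto simp: in_keys_iff)
  also have "\<dots> = (\<Sum>a\<in>A. \<Sum>b\<in>B.
      mhv_scale (Poly_Mapping.lookup x a * Poly_Mapping.lookup y b) (mhv_basis_bracket a b))"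
    using assms by (intro sum.mono_neutral_left) (auto simp: in_keys_iff)
  finally show ?thesis .
qed

lemma mhv_bracket_single [simp]:
  "mhv_bracket (Poly_Mapping.single a s) (Poly_Mapping.single b t) =
     mhv_scale (s * t) (mhv_basis_bracket a b)"
  by (subst mhv_bracket_superset[of "{a}" "{b}"]) auto

lemma mhv_bracket_add_left: "mhv_bracket (x + x') y = mhv_bracket x y + mhv_bracket x' y"
proof -
  let ?A = "Poly_Mapping.keys x \<union> Poly_Mapping.keys x'" and ?B = "Poly_Mapping.keys y"
  have "Poly_Mapping.keys (x + x') \<subseteq> ?A"
    by (rule Poly_Mapping.keys_add)
  then show ?thesis
    by (simp add: mhv_bracket_superset[of ?A ?B] lookup_add algebra_simps
        mhv.scale_left_distrib sum.distrib)
qed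

lemma mhv_bracket_add_right: "mhv_bracket x (y + y') = mhv_bracket x y + mhv_bracket x y'"
proof -
  let ?B = "Poly_Mapping.keys y \<union> Poly_Mapping.keys y'" and ?A = "Poly_Mapping.keys x"
  have "Poly_Mapping.keys (y + y') \<subseteq> ?B"
    by (rule Poly_Mapping.keys_add)
  then show ?thesis
    by (simp add: mhv_bracket_superset[of ?A ?B] lookup_add algebra_simps
        mhv.scale_left_distrib sum.distrib)
qed

lemma keys_mhv_scale: "Poly_Mapping.keys (mhv_scale a x) \<subseteq> Poly_Mapping.keys x"
  by (auto simp: in_keys_iff)

lemma mhv_bracket_scale_left: "mhv_bracket (mhv_scale a x) y = mhv_scale a (mhv_bracket x y)"
  by (subst mhv_bracket_superset[OF _ _ keys_mhv_scale order_refl])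
     (auto simp: mhv_bracket_def mhv.scale_sum_right mult.assoc)

lemma mhv_bracket_scale_right: "mhv_bracket x (mhv_scale a y) = mhv_scale a (mhv_bracket x y)"
  by (subst mhv_bracket_superset[OF _ _ order_refl keys_mhv_scale])
     (auto simp: mhv_bracket_def mhv.scale_sum_right mult_ac)

lemma mhv_bracket_zero [simp]: "mhv_bracket 0 y = 0" "mhv_bracket x 0 = 0"
  by (simp_all add: mhv_bracket_def)

lemma half_index_add_eq_0: "half_index j + half_index k = 0 \<longleftrightarrow> j + k + 1 = 0"
proof -
  have "half_index j + half_index k = of_int (j + k + 1)"
    by (simp add: half_index_def)
  then show ?thesis
    by (metis of_int_eq_0_iff)
qed

lemma mhv_basis_bracket_antisym: "mhv_basis_bracket a b = - mhv_basis_bracket b a"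
proof (cases a; cases b)
  fix m n assume a: "a = Dgen m" and b: "b = Dgen n"
  show ?thesis
  proof (cases "m + n = 0")
    case True
    then have "n = - m" by simp
    then show ?thesis
      by (intro poly_mapping_eqI)
         (simp add: a b lookup_add lookup_minus lookup_uminus lookup_single when_def field_simps power3_eq_cube)
  next
    case False
    then show ?thesis
      by (intro poly_mapping_eqI)
         (auto simp: a b lookup_add lookup_minus lookup_uminus lookup_single when_def add.commute)
  qed
next
  fix j k assume a: "a = Hgen j" and b: "b = Hgen k"
  then show ?thesis
    by (auto intro!: poly_mapping_eqI simp: lookup_uminus lookup_single when_def add.commute add_eq_0_iff)
qed (auto intro!: poly_mapping_eqI simp: lookup_uminus lookup_single when_def)

lemma mhv_bracket_antisym: "mhv_bracket x y = - mhv_bracket y x"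
proof -
  have "mhv_bracket x y = (\<Sum>a\<in>Poly_Mapping.keys x. \<Sum>b\<in>Poly_Mapping.keys y.
      - mhv_scale (Poly_Mapping.lookup y b * Poly_Mapping.lookup x a) (mhv_basis_bracket b a))"
    unfolding mhv_bracket_def
    by (intro sum.cong refl, subst mhv_basis_bracket_antisym) (simp add: mult.commute)
  also have "\<dots> = - mhv_bracket y x"
    unfolding mhv_bracket_def by (subst sum.swap) (simp add: sum_negf)
  finally show ?thesis .
qed

lemma mhv_bracket_self: "mhv_bracket x x = 0"
proof (rule poly_mapping_eqI)
  fix b
  have "Poly_Mapping.lookup (mhv_bracket x x) b = - Poly_Mapping.lookup (mhv_bracket x x) b"
    by (metis mhv_bracket_antisym lookup_uminus)
  then show "Poly_Mapping.lookup (mhv_bracket x x) b = Poly_Mapping.lookup 0 b"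
    by simp
qed

lemma mhv_induct [case_names single add]:
  assumes "\<And>a s. P (Poly_Mapping.single a s)" and "\<And>x y. P x \<Longrightarrow> P y \<Longrightarrow> P (x + y)"
  shows "P (x :: mhv)"
proof -
  have P0: "P 0" using assms(1)[of Cgen 0] by simp
  have "P (\<Sum>a\<in>A. Poly_Mapping.single a (Poly_Mapping.lookup x a))" if "finite A" for A
    using that by (induction A rule: finite_induct) (auto intro: assms P0)
  moreover have "x = (\<Sum>a\<in>Poly_Mapping.keys x. Poly_Mapping.single a (Poly_Mapping.lookup x a))"
    by (rule poly_mapping_eqI) (simp add: lookup_sum lookup_single when_def in_keys_iff)
  ultimately show ?thesis
    by (metis finite_keys)
qed

lemma mhv_jacobi_basis:
  fixes a b c :: mhv_basis
  defines "s \<equiv> \<lambda>a. Poly_Mapping.single a (1::complex)"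
  shows "mhv_bracket (s a) (mhv_bracket (s b) (s c)) + mhv_bracket (s b) (mhv_bracket (s c) (s a))
     + mhv_bracket (s c) (mhv_bracket (s a) (s b)) = 0"
proof -
  have DDD: "mhv_bracket (s (Dgen m)) (mhv_bracket (s (Dgen n)) (s (Dgen k)))
      + mhv_bracket (s (Dgen n)) (mhv_bracket (s (Dgen k)) (s (Dgen m)))
      + mhv_bracket (s (Dgen k)) (mhv_bracket (s (Dgen m)) (s (Dgen n))) = 0" for m n k
  proof -
    have B: "mhv_bracket (s (Dgen m)) (mhv_bracket (s (Dgen n)) (s (Dgen k)))
      = Poly_Mapping.single (Dgen (m + n + k)) (of_int ((n - k) * (m - (n + k))))
        + Poly_Mapping.single Cgen
           (if m + n + k = 0 then of_int ((n - k) * (m ^ 3 - m)) / 12 else 0)" for m n k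
      by (auto simp: s_def mhv_bracket_add_right mhv.scale_right_distrib add.assoc)
    show ?thesis
    proof (cases "m + n + k = 0")
      case True
      then have k: "k = - m - n" by simp
      show ?thesis
        by (rule poly_mapping_eqI)
           (simp add: B k lookup_add lookup_single when_def field_simps power3_eq_cube)
    next
      case False
      then have "n + k + m \<noteq> 0" "k + m + n \<noteq> 0" by auto
      with False show ?thesis
        by (intro poly_mapping_eqI)
           (auto simp: B lookup_add lookup_single when_def algebra_simps)
    qed
  qed
  have DDH: "mhv_bracket (s (Dgen m)) (mhv_bracket (s (Dgen n)) (s (Hgen k)))
      + mhv_bracket (s (Dgen n)) (mhv_bracket (s (Hgen k)) (s (Dgen m)))
      + mhv_bracket (s (Hgen k)) (mhv_bracket (s (Dgen m)) (s (Dgen n))) = 0" for m n k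
    by (rule poly_mapping_eqI)
       (auto simp: s_def mhv_bracket_add_right mhv.scale_right_distrib lookup_add lookup_single
          when_def half_index_def field_simps)
  have DHH: "mhv_bracket (s (Dgen m)) (mhv_bracket (s (Hgen j)) (s (Hgen k)))
      + mhv_bracket (s (Hgen j)) (mhv_bracket (s (Hgen k)) (s (Dgen m)))
      + mhv_bracket (s (Hgen k)) (mhv_bracket (s (Dgen m)) (s (Hgen j))) = 0" for m j k
  proof (cases "m + j + k + 1 = 0")
    case True
    then have "half_index j + half_index (m + k) = 0" "half_index k + half_index (m + j) = 0"
      by (auto simp: half_index_add_eq_0)
    then show ?thesis
      by (auto simp: s_def mult.commute simp flip: single_add single_uminus)
  next
    case False
    then have "half_index j + half_index (m + k) \<noteq> 0" "half_index k + half_index (m + j) \<noteq> 0"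
      by (auto simp: half_index_add_eq_0)
    then show ?thesis
      by (auto simp: s_def)
  qed
  have zeroC [simp]: "mhv_bracket (s Cgen) x = 0" "mhv_bracket x (s Cgen) = 0"
    and zeroL [simp]: "mhv_bracket (s Lgen) x = 0" "mhv_bracket x (s Lgen) = 0" for x
  proof -
    show "mhv_bracket (s Cgen) x = 0" "mhv_bracket (s Lgen) x = 0"
      by (simp_all add: mhv_bracket_def s_def)
    have "mhv_basis_bracket b Cgen = 0" "mhv_basis_bracket b Lgen = 0" for b
      by (cases b; simp)+
    then show "mhv_bracket x (s Cgen) = 0" "mhv_bracket x (s Lgen) = 0"
      by (simp_all add: mhv_bracket_def s_def)
  qed
  have HHH: "mhv_bracket (s (Hgen i)) (mhv_bracket (s (Hgen j)) (s (Hgen k))) = 0" for i j k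
    by (simp add: s_def)
  show ?thesis
  proof (cases a; cases b; cases c)
    fix m j k assume "a = Hgen j" "b = Dgen m" "c = Hgen k"
    then show ?thesis using DHH[of m k j] by (simp add: add_ac)
  next
    fix m j k assume "a = Hgen j" "b = Hgen k" "c = Dgen m"
    then show ?thesis using DHH[of m j k] by (simp add: add_ac)
  next
    fix m n k assume "a = Dgen m" "b = Hgen k" "c = Dgen n"
    then show ?thesis using DDH[of n m k] by (simp add: add_ac)
  next
    fix m n k assume "a = Hgen k" "b = Dgen m" "c = Dgen n"
    then show ?thesis using DDH[of m n k] by (simp add: add_ac)
  qed (simp_all add: DDD DDH DHH HHH)
qed

lemma mhv_jacobi:
  "mhv_bracket x (mhv_bracket y z) + mhv_bracket y (mhv_bracket z x)
     + mhv_bracket z (mhv_bracket x y) = 0"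
proof (induction x rule: mhv_induct)
  case (single a r)
  show ?case
  proof (induction y rule: mhv_induct)
    case (single b s)
    show ?case
    proof (induction z rule: mhv_induct)
      case (single c t)
      let ?J = "mhv_bracket (Poly_Mapping.single a 1)
            (mhv_bracket (Poly_Mapping.single b 1) (Poly_Mapping.single c 1))
          + mhv_bracket (Poly_Mapping.single b 1)
            (mhv_bracket (Poly_Mapping.single c 1) (Poly_Mapping.single a 1))
          + mhv_bracket (Poly_Mapping.single c 1)
            (mhv_bracket (Poly_Mapping.single a 1) (Poly_Mapping.single b 1))"
      have *: "Poly_Mapping.single d u = mhv_scale u (Poly_Mapping.single d 1)" for d u
        by simp
      have "mhv_scale (r * s * t) ?J = 0"
        by (simp only: mhv_jacobi_basis mhv.scale_zero_right)
      then show ?case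
        by (subst (1 2 3) *[of a r], subst (1 2 3) *[of b s], subst (1 2 3) *[of c t])
           (simp only: mhv_bracket_scale_left mhv_bracket_scale_right mhv.scale_scale
              mhv.scale_right_distrib mult_ac)
    next
      case (add z z')
      then show ?case
        by (simp add: mhv_bracket_add_left mhv_bracket_add_right add_eq_0_iff algebra_simps)
    qed
  next
    case (add y y')
    then show ?case
      by (simp add: mhv_bracket_add_left mhv_bracket_add_right add_eq_0_iff algebra_simps)
  qed
next
  case (add x x')
  then show ?case
    by (simp add: mhv_bracket_add_left mhv_bracket_add_right add_eq_0_iff algebra_simps)
qed

end

theory Submission
  imports Defs
begin

text \<open>
  The derivations of the algebra are the maps \<open>ad u + \<mu> \<sigma>\<close>, where \<open>\<sigma>\<close> multiplies \<open>h\<^sub>r\<close> by 1,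
  \<open>\<^bold>l\<close> by 2, and \<open>d\<^sub>m\<close> and \<open>\<^bold>c\<close> by 0 (\<open>derivation_inner_plus_h_degree\<close>): subtracting an inner
  derivation makes a derivation commute with \<open>ad d\<^sub>0\<close>, hence diagonal on the generators \<open>d\<^sub>m\<close> and
  \<open>h\<^sub>r\<close>, and the brackets of basis vectors leave only two free parameters
  (\<open>derivation_diagonal\<close>).

  So a derivation that kills \<open>d\<^sub>0\<close> is \<open>\<alpha> ad d\<^sub>0 + \<mu> \<sigma>\<close>, which is diagonal. For odd \<open>n\<close>, a
  derivation that kills \<open>z\<^sub>n = d\<^sub>n + h\<^sub>n\<^sub>/\<^sub>2\<close> is \<open>\<beta> ad z\<^sub>n\<close> (\<open>derivation_killing_stab_vec\<close>): the summand
  \<open>h\<^sub>n\<^sub>/\<^sub>2\<close> is there to exclude \<open>\<sigma>\<close>. For \<open>n > 0\<close> the operator \<open>ad z\<^sub>n\<close> raises degrees, so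
  \<open>\<beta> [z\<^sub>n, x]\<close> can be a coordinatewise multiple of \<open>x\<close> only if it is 0, unless the leading
  Virasoro term of \<open>x\<close> is a multiple of \<open>d\<^sub>n\<close>, which \<open>d\<^sub>n\<close> kills (\<open>ad_stab_vec_diagonal_imp_zero\<close>).

  Given a 2-local derivation \<open>\<Delta>\<close>, choose one derivation \<open>\<delta>\<close> that agrees with it at \<open>d\<^sub>0\<close> and at
  \<open>z\<^sub>1\<close>. At any \<open>x\<close>, the difference \<open>\<Delta> x - \<delta> x\<close> is the value there of a derivation killing \<open>d\<^sub>0\<close> and also
  of one killing \<open>z\<^sub>1\<close>, so it vanishes unless \<open>x\<close> has top degree 1. In particular
  \<open>\<Delta> z\<^sub>3 = \<delta> z\<^sub>3\<close>, and the same argument with \<open>z\<^sub>3\<close> in place of \<open>z\<^sub>1\<close> covers the remaining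
  \<open>x\<close>. Hence \<open>\<Delta> = \<delta>\<close>; linearity of \<open>\<Delta>\<close> comes out of this comparison.
\<close>

section \<open>Coordinates of brackets\<close>

abbreviation coord :: "mhv \<Rightarrow> mhv_basis \<Rightarrow> complex" where
  "coord \<equiv> Poly_Mapping.lookup"

lemma bracket_diff_left: "mhv_bracket (x - y) z = mhv_bracket x z - mhv_bracket y z"
  by (metis mhv_bracket_add_left add_diff_cancel_right' diff_add_cancel)

lemma bracket_diff_right: "mhv_bracket x (y - z) = mhv_bracket x y - mhv_bracket x z"
  by (metis mhv_bracket_add_right add_diff_cancel_right' diff_add_cancel)

lemma bracket_central_left:
  "mhv_bracket (Poly_Mapping.single Cgen s) x = 0" "mhv_bracket (Poly_Mapping.single Lgen s) x = 0"
  by (simp_all add: mhv_bracket_def)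

lemma half_index_nonzero [simp]: "half_index k \<noteq> 0"
proof
  assume "half_index k = 0"
  then have "half_index k + half_index k = 0" by simp
  then show False unfolding half_index_add_eq_0 by presburger
qed

lemma half_index_inj [simp]: "half_index j = half_index k \<longleftrightarrow> j = k"
  by (simp add: half_index_def)

lemma half_index_neq_of_int: "half_index k \<noteq> of_int m"
proof
  assume "half_index k = of_int m"
  moreover have "half_index (k - m) = half_index k - of_int m" by (simp add: half_index_def)
  ultimately have "half_index (k - m) = 0" by simp
  then show False by simp
qed

abbreviation d_vec :: "int \<Rightarrow> mhv" where
  "d_vec n \<equiv> Poly_Mapping.single (Dgen n) 1"

abbreviation h_vec :: "int \<Rightarrow> mhv" where
  "h_vec k \<equiv> Poly_Mapping.single (Hgen k) 1"

lemma lookup_bracket_d_vec: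
  "coord (mhv_bracket (d_vec n) x) (Dgen m) = of_int (2 * n - m) * coord x (Dgen (m - n))"
  "coord (mhv_bracket (d_vec n) x) (Hgen j) = - half_index (j - n) * coord x (Hgen (j - n))"
  "coord (mhv_bracket (d_vec n) x) Cgen = of_int (n ^ 3 - n) / 12 * coord x (Dgen (- n))"
  "coord (mhv_bracket (d_vec n) x) Lgen = 0"
proof (induction x rule: mhv_induct)
  case (single a s)
  { case 1 show ?case by (cases a) (auto simp: lookup_add lookup_single when_def)
  next case 2 show ?case by (cases a) (auto simp: lookup_add lookup_single when_def)
  next case 3 show ?case by (cases a) (auto simp: lookup_add lookup_single when_def)
  next case 4 show ?case by (cases a) (auto simp: lookup_add lookup_single when_def) }
next
  case (add x y)
  { case 1 show ?case by (simp add: add mhv_bracket_add_right lookup_add algebra_simps)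
  next case 2 show ?case by (simp add: add mhv_bracket_add_right lookup_add algebra_simps)
  next case 3 show ?case by (simp add: add mhv_bracket_add_right lookup_add distrib_left)
  next case 4 show ?case by (simp add: add mhv_bracket_add_right lookup_add algebra_simps) }
qed

lemma lookup_bracket_h_vec:
  "coord (mhv_bracket (h_vec k) x) (Dgen m) = 0"
  "coord (mhv_bracket (h_vec k) x) (Hgen j) = half_index k * coord x (Dgen (j - k))"
  "coord (mhv_bracket (h_vec k) x) Lgen = half_index k * coord x (Hgen (- k - 1))"
proof (induction x rule: mhv_induct)
  case (single a s)
  { case 1 show ?case by (cases a) (auto simp: lookup_add lookup_single when_def)
  next case 2 show ?case by (cases a) (auto simp: lookup_add lookup_single when_def)
  next case 3 show ?case
      by (cases a) (auto simp: lookup_add lookup_single when_def half_index_add_eq_0) }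
next
  case (add x y)
  { case 1 show ?case by (simp add: add mhv_bracket_add_right lookup_add algebra_simps)
  next case 2 show ?case by (simp add: add mhv_bracket_add_right lookup_add algebra_simps)
  next case 3 show ?case by (simp add: add mhv_bracket_add_right lookup_add algebra_simps) }
qed

text \<open>The eigenvalues of \<open>- ad d\<^sub>0\<close> on the basis. Integer and half-integer weights never meet, and
  all nonzero weights have multiplicity one; only weight 0 mixes \<open>d\<^sub>0\<close>, \<open>\<^bold>c\<close> and \<open>\<^bold>l\<close>.\<close>

fun weight :: "mhv_basis \<Rightarrow> complex" where
  "weight (Dgen m) = of_int m"
| "weight (Hgen k) = half_index k"
| "weight _ = 0"

lemma lookup_bracket_d_zero: "coord (mhv_bracket (d_vec 0) x) b = - weight b * coord x b"
  by (cases b) (simp_all add: lookup_bracket_d_vec)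

section \<open>Derivations\<close>

lemma derivationD:
  assumes "derivation mhv_scale mhv_bracket \<delta>"
  shows "\<delta> (x + y) = \<delta> x + \<delta> y" "\<delta> (mhv_scale a x) = mhv_scale a (\<delta> x)"
    "\<delta> (mhv_bracket x y) = mhv_bracket (\<delta> x) y + mhv_bracket x (\<delta> y)"
  using assms by (auto simp: derivation_def Vector_Spaces.linear_iff)

lemma derivation_diff:
  assumes "derivation mhv_scale mhv_bracket \<delta>" "derivation mhv_scale mhv_bracket \<delta>'"
  shows "derivation mhv_scale mhv_bracket (\<lambda>x. \<delta> x - \<delta>' x)"
  using assms
  by (auto simp: derivation_def Vector_Spaces.linear_iff mhv.scale_right_diff_distrib
      bracket_diff_left bracket_diff_right)

lemma derivation_ad: "derivation mhv_scale mhv_bracket (mhv_bracket u)"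
proof -
  have "mhv_bracket u (mhv_bracket x y)
      = mhv_bracket (mhv_bracket u x) y + mhv_bracket x (mhv_bracket u y)" for x y
  proof -
    have "mhv_bracket x (mhv_bracket y u) = - mhv_bracket x (mhv_bracket u y)"
      by (metis mhv_bracket_antisym[of y u] bracket_diff_right diff_0 mhv_bracket_zero(2))
    moreover have "mhv_bracket y (mhv_bracket u x) = - mhv_bracket (mhv_bracket u x) y"
      by (rule mhv_bracket_antisym)
    ultimately show ?thesis using mhv_jacobi[of u x y] by (simp add: algebra_simps)
  qed
  then show ?thesis
    by (simp add: derivation_def Vector_Spaces.linear_iff mhv.vector_space_axioms
        mhv_bracket_add_right mhv_bracket_scale_right)
qed

text \<open>The number of letters \<open>h\<close> needed to produce a basis vector, since \<open>[h\<^sub>r, h\<^sub>-\<^sub>r] = r \<^bold>l\<close>. The algebra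
  is graded by it, so it gives a derivation, which is outer.\<close>

fun h_degree :: "mhv_basis \<Rightarrow> complex" where
  "h_degree (Hgen k) = 1"
| "h_degree Lgen = 2"
| "h_degree _ = 0"

text \<open>The hypothesis puts \<open>\<delta> d\<^sub>0\<close> in weight 0, and \<open>[d\<^sub>0, d\<^sub>1] = - d\<^sub>1\<close> then makes it
  central. So \<open>\<delta>\<close> commutes with \<open>ad d\<^sub>0\<close> and preserves weights: \<open>\<delta> d\<^sub>m = a\<^sub>m d\<^sub>m\<close> and \<open>\<delta> h\<^sub>k = e\<^sub>k h\<^sub>k\<close>. The brackets \<open>[d\<^sub>m, d\<^sub>n]\<close> force
  \<open>a\<^sub>m = m a\<^sub>1\<close>, and \<open>[d\<^sub>m, h\<^sub>k]\<close> forces \<open>e\<^sub>k = k a\<^sub>1 + e\<^sub>0\<close>; \<open>\<^bold>c\<close> and \<open>\<^bold>l\<close> are brackets of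
  these vectors, up to \<open>d\<^sub>0\<close>. Here \<open>h\<^sub>k\<close> carries its integer code.\<close>

lemma derivation_diagonal:
  assumes der: "derivation mhv_scale mhv_bracket \<delta>"
    and van: "\<And>b. weight b \<noteq> 0 \<Longrightarrow> coord (\<delta> (d_vec 0)) b = 0"
  shows "\<exists>\<alpha> \<mu>. \<forall>x b. coord (\<delta> x) b
        = (- \<alpha> * weight b + \<mu> * h_degree b) * coord x b"
proof -
  note D = derivationD[OF der]
  have Dsingle: "\<delta> (Poly_Mapping.single b s) = mhv_scale s (\<delta> (Poly_Mapping.single b 1))" for b s
    by (metis D(2) mhv_scale_single mult.right_neutral)
  \<comment> \<open>A multiple of \<open>d\<^sub>0\<close> in \<open>\<delta> d\<^sub>0\<close> would rescale the weight of \<open>d\<^sub>1\<close>, which \<open>[d\<^sub>0, d\<^sub>1] = - d\<^sub>1\<close> fixes.\<close>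
  have d0_D: "coord (\<delta> (d_vec 0)) (Dgen 0) = 0"
  proof -
    have "\<delta> (mhv_bracket (d_vec 0) (d_vec 1))
        = mhv_bracket (d_vec 0) (\<delta> (d_vec 1)) - mhv_bracket (d_vec 1) (\<delta> (d_vec 0))"
      unfolding D(3) using mhv_bracket_antisym[of "\<delta> (d_vec 0)" "d_vec 1"] by simp
    moreover have "\<delta> (mhv_bracket (d_vec 0) (d_vec 1)) = mhv_scale (-1) (\<delta> (d_vec 1))"
      by (simp add: Dsingle[of _ "-1"])
    ultimately have "coord (mhv_scale (-1) (\<delta> (d_vec 1))) (Dgen 1)
        = coord (mhv_bracket (d_vec 0) (\<delta> (d_vec 1)) - mhv_bracket (d_vec 1) (\<delta> (d_vec 0))) (Dgen 1)"
      by simp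
    then show ?thesis
      by (simp add: lookup_minus lookup_bracket_d_vec)
  qed
  have "\<delta> (d_vec 0) = Poly_Mapping.single Cgen (coord (\<delta> (d_vec 0)) Cgen)
      + Poly_Mapping.single Lgen (coord (\<delta> (d_vec 0)) Lgen)"
  proof (rule poly_mapping_eqI)
    fix b show "coord (\<delta> (d_vec 0)) b = coord (Poly_Mapping.single Cgen (coord (\<delta> (d_vec 0)) Cgen)
      + Poly_Mapping.single Lgen (coord (\<delta> (d_vec 0)) Lgen)) b"
      using van[of b] d0_D by (cases b) (auto simp: lookup_add lookup_single)
  qed
  then have d0_central: "mhv_bracket (\<delta> (d_vec 0)) x = 0" for x
    by (metis mhv_bracket_add_left bracket_central_left add_0)
  have diag: "coord (\<delta> (Poly_Mapping.single b 1)) b' = 0" if "weight b' \<noteq> weight b" for b b'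
  proof -
    have "mhv_bracket (d_vec 0) (Poly_Mapping.single b 1) = mhv_scale (- weight b) (Poly_Mapping.single b 1)"
      by (rule poly_mapping_eqI, cases b)
        (auto simp: lookup_bracket_d_zero lookup_add lookup_single when_def)
    then have "mhv_scale (- weight b) (\<delta> (Poly_Mapping.single b 1))
        = mhv_bracket (d_vec 0) (\<delta> (Poly_Mapping.single b 1))"
      using D(3)[of "d_vec 0" "Poly_Mapping.single b 1"] D(2) d0_central by (metis add_0)
    from arg_cong[OF this, of "\<lambda>z. coord z b'"] show ?thesis
      using that by (simp add: lookup_bracket_d_zero)
  qed
  define a where "a m = coord (\<delta> (d_vec m)) (Dgen m)" for m
  define e where "e k = coord (\<delta> (h_vec k)) (Hgen k)" for k
  have dm': "\<delta> (d_vec m) = Poly_Mapping.single (Dgen m) (a m)" if "m \<noteq> 0" for m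
  proof (rule poly_mapping_eqI)
    fix b show "coord (\<delta> (d_vec m)) b = coord (Poly_Mapping.single (Dgen m) (a m)) b"
      using that diag[of b "Dgen m"]
      by (cases b) (auto simp: lookup_single when_def a_def half_index_neq_of_int)
  qed
  have hk: "\<delta> (h_vec k) = Poly_Mapping.single (Hgen k) (e k)" for k
  proof (rule poly_mapping_eqI)
    fix b show "coord (\<delta> (h_vec k)) b = coord (Poly_Mapping.single (Hgen k) (e k)) b"
      using diag[of b "Hgen k"]
      by (cases b)
        (auto simp: lookup_single when_def e_def half_index_neq_of_int half_index_neq_of_int[symmetric]
           half_index_nonzero[symmetric] simp del: half_index_nonzero)
  qed
  \<comment> \<open>In \<open>[d\<^sub>1, d\<^sub>-\<^sub>1] = 2 d\<^sub>0\<close> the cocycle vanishes, so this bracket determines \<open>\<delta> d\<^sub>0\<close> alone.\<close>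
  have d0': "mhv_scale 2 (\<delta> (d_vec 0)) = Poly_Mapping.single (Dgen 0) (2 * (a 1 + a (- 1)))"
    using D(3)[of "d_vec 1" "d_vec (- 1)"]
    by (simp add: dm' Dsingle[of _ 2] flip: single_add) (simp add: algebra_simps)
  have a_neg: "a (- 1) = - a 1"
    using arg_cong[OF d0', of "\<lambda>z. coord z (Dgen 0)"] d0_D by (simp add: add_eq_0_iff)
  have d0: "\<delta> (d_vec 0) = 0"
    using d0' a_neg by (simp add: mhv.scale_eq_0_iff)
  have dm: "\<delta> (d_vec m) = Poly_Mapping.single (Dgen m) (a m)" for m
    using dm' d0 by (cases "m = 0") (auto simp: a_def)
  have a_add: "a (m + n) = a m + a n" if "m \<noteq> n" "m + n \<noteq> 0" for m n
  proof -
    have "Poly_Mapping.single (Dgen (m + n)) (of_int (m - n) * a (m + n))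
      = Poly_Mapping.single (Dgen (m + n)) (of_int (m - n) * (a m + a n))"
      using D(3)[of "d_vec m" "d_vec n"] that
      by (simp add: dm Dsingle[of _ "of_int m - of_int n"] flip: single_add) (simp add: algebra_simps)
    from arg_cong[OF this, of "\<lambda>z. coord z (Dgen (m + n))"] show ?thesis
      using that by simp
  qed
  have a0: "a 0 = 0" using d0 by (simp add: a_def)
  \<comment> \<open>\<open>[d\<^sub>1, d\<^sub>1] = 0\<close> says nothing about \<open>a\<^sub>2\<close>; computing \<open>a\<^sub>5\<close> as \<open>4 + 1\<close> and as \<open>3 + 2\<close> does.\<close>
  have a2: "a 2 = 2 * a 1"
    using a_add[of 2 1] a_add[of 3 1] a_add[of 4 1] a_add[of 3 2] by simp
  have a_Suc: "a (m + 1) = a m + a 1" for m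
  proof (cases "m = 1 \<or> m = - 1")
    case True then show ?thesis using a2 a_neg a0 by auto
  next
    case False then show ?thesis using a_add[of m 1] by auto
  qed
  have a_lin: "a m = of_int m * a 1" for m
  proof (induction m rule: int_induct[of _ 0])
    case base then show ?case by (simp add: a0)
  next
    case (step1 i) then show ?case by (simp add: a_Suc distrib_right)
  next
    case (step2 i) then show ?case using a_Suc[of "i - 1"] by (simp add: left_diff_distrib eq_diff_eq)
  qed
  \<comment> \<open>The smallest bracket with a nonzero cocycle is \<open>[d\<^sub>2, d\<^sub>-\<^sub>2] = 4 d\<^sub>0 + \<^bold>c / 2\<close>.\<close>
  have c0: "\<delta> (Poly_Mapping.single Cgen 1) = 0"
  proof -
    have "a (- 2) = - a 2" by (simp add: a_lin[of 2] a_lin[of "- 2"])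
    then have "mhv_scale (1 / 2) (\<delta> (Poly_Mapping.single Cgen 1)) = 0"
      using D(3)[of "d_vec 2" "d_vec (- 2)"]
      by (simp add: dm D(1) Dsingle[of _ 4] Dsingle[of _ "1/2"] a0 flip: single_add)
    then show ?thesis by (simp add: mhv.scale_eq_0_iff)
  qed
  have e_lin: "e k = of_int k * a 1 + e 0" for k
  proof -
    have "Poly_Mapping.single (Hgen k) (- half_index 0 * e k)
       = Poly_Mapping.single (Hgen k) (- half_index 0 * (a k + e 0))"
      using D(3)[of "d_vec k" "h_vec 0"]
      by (simp add: dm hk Dsingle[of _ "- half_index 0"] flip: single_add) (simp add: algebra_simps)
    from arg_cong[OF this, of "\<lambda>z. coord z (Hgen k)"] show ?thesis
      by (simp add: a_lin[of k])
  qed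
  have l: "\<delta> (Poly_Mapping.single Lgen 1) = Poly_Mapping.single Lgen (2 * e 0 - a 1)"
  proof -
    have "mhv_scale (1 / 2) (\<delta> (Poly_Mapping.single Lgen 1))
      = mhv_scale (1 / 2) (Poly_Mapping.single Lgen (2 * e 0 - a 1))"
      using D(3)[of "h_vec 0" "h_vec (- 1)"]
      by (simp add: hk Dsingle[of _ "1/2"] half_index_def e_lin[of "- 1"] flip: single_add)
        (simp add: field_simps)
    then show ?thesis by (simp del: mhv_scale_single)
  qed
  have "coord (\<delta> x) b = (a 1 * weight b + (e 0 - a 1 / 2) * h_degree b) * coord x b" for x b
  proof (induction x rule: mhv_induct)
    case (single c s)
    have e': "e k = (half_index k - 1 / 2) * a 1 + e 0" for k
      using e_lin[of k] by (simp add: half_index_def)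
    have dm': "\<delta> (d_vec m) = Poly_Mapping.single (Dgen m) (of_int m * a 1)" for m
      using dm[of m] a_lin[of m] by simp
    have hk': "\<delta> (h_vec k)
        = Poly_Mapping.single (Hgen k) ((half_index k - 1 / 2) * a 1 + e 0)" for k
      using hk[of k] e'[of k] by simp
    show ?case
      unfolding Dsingle[of c s]
      by (cases c; cases b)
        (auto simp: dm' hk' c0 l lookup_single when_def algebra_simps)
  next
    case (add x y)
    then show ?case by (simp only: D(1) lookup_add distrib_left)
  qed
  \<comment> \<open>The shift by \<open>a\<^sub>1 / 2\<close> turns the code \<open>k\<close> into the weight \<open>k + 1/2\<close>.\<close>
  then show ?thesis by (intro exI[of _ "- a 1"] exI[of _ "e 0 - a 1 / 2"]) simp
qed

text \<open>Away from weight 0 the operator \<open>ad d\<^sub>0\<close> is invertible, so some inner derivation agrees with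
  \<open>\<delta>\<close> at \<open>d\<^sub>0\<close> in all nonzero weights; what is left is diagonal.\<close>

lemma derivation_inner_plus_h_degree:
  assumes der: "derivation mhv_scale mhv_bracket \<delta>"
  shows "\<exists>u \<mu>. \<forall>x b. coord (\<delta> x) b = coord (mhv_bracket u x) b + \<mu> * h_degree b * coord x b"
proof -
  \<comment> \<open>In weight 0 the quotient is 0.\<close>
  define u where "u = Poly_Mapping.mapp (\<lambda>b t. t / weight b) (\<delta> (d_vec 0))"
  have u: "coord u b = coord (\<delta> (d_vec 0)) b / weight b" for b
    by (simp add: u_def lookup_mapp when_def in_keys_iff)
  have "derivation mhv_scale mhv_bracket (\<lambda>x. \<delta> x - mhv_bracket u x)"
    by (intro derivation_diff der derivation_ad)
  moreover have "coord (\<delta> (d_vec 0) - mhv_bracket u (d_vec 0)) b = 0" if "weight b \<noteq> 0" for b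
    unfolding mhv_bracket_antisym[of u] using that
    by (simp add: lookup_add lookup_bracket_d_zero u)
  ultimately obtain \<alpha> \<mu> where E: "\<And>x b. coord (\<delta> x - mhv_bracket u x) b
      = (- \<alpha> * weight b + \<mu> * h_degree b) * coord x b"
    using derivation_diagonal by blast
  have "coord (\<delta> x) b = coord (mhv_bracket (u + mhv_scale \<alpha> (d_vec 0)) x) b
      + \<mu> * h_degree b * coord x b" for x b
    using E[of x b] unfolding mhv_bracket_add_left mhv_bracket_scale_left
    by (simp add: lookup_add lookup_minus lookup_bracket_d_zero algebra_simps)
  then show ?thesis by blast
qed

section \<open>Derivations killing a test vector\<close>

lemma bracket_left_cong_mod_center:
  assumes "\<And>m. coord u (Dgen m) = coord v (Dgen m)" "\<And>k. coord u (Hgen k) = coord v (Hgen k)"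
  shows "mhv_bracket u x = mhv_bracket v x"
proof -
  have "u - v = Poly_Mapping.single Cgen (coord (u - v) Cgen)
      + Poly_Mapping.single Lgen (coord (u - v) Lgen)" (is "_ = ?w")
  proof (rule poly_mapping_eqI)
    fix b show "coord (u - v) b = coord ?w b"
      using assms by (cases b) (auto simp: lookup_add lookup_minus lookup_single)
  qed
  then have "mhv_bracket (u - v) x = 0"
    by (metis mhv_bracket_add_left bracket_central_left add_0)
  then show ?thesis by (simp add: bracket_diff_left)
qed

text \<open>\<open>d\<^sub>n + h\<^sub>n\<^sub>/\<^sub>2\<close> for \<open>n = 2 k + 1\<close>, as \<open>n / 2\<close> has the code \<open>k\<close>. The index \<open>n / 2\<close> is chosen so that
  the only vector \<open>h\<^sub>r\<close> with \<open>[d\<^sub>n, h\<^sub>r]\<close> proportional to \<open>h\<^sub>n\<^sub>/\<^sub>2\<close> is \<open>h\<^sub>-\<^sub>n\<^sub>/\<^sub>2\<close>, which does not commute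
  with \<open>h\<^sub>n\<^sub>/\<^sub>2\<close>.\<close>

definition stab_vec :: "int \<Rightarrow> mhv" where
  "stab_vec k = d_vec (2 * k + 1) + h_vec k"

lemma lookup_bracket_stab_vec:
  "coord (mhv_bracket (stab_vec k) x) (Dgen m)
     = of_int (4 * k + 2 - m) * coord x (Dgen (m - (2 * k + 1)))"
  "coord (mhv_bracket (stab_vec k) x) (Hgen j)
     = half_index k * coord x (Dgen (j - k))
       - half_index (j - (2 * k + 1)) * coord x (Hgen (j - (2 * k + 1)))"
  "coord (mhv_bracket (stab_vec k) x) Lgen = half_index k * coord x (Hgen (- k - 1))"
  by (simp_all add: stab_vec_def mhv_bracket_add_left lookup_add lookup_bracket_d_vec
      lookup_bracket_h_vec)

lemma lookup_stab_vec [simp]: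
  "coord (stab_vec k) (Dgen m) = (if m = 2 * k + 1 then 1 else 0)"
  "coord (stab_vec k) (Hgen j) = (if j = k then 1 else 0)"
  "coord (stab_vec k) Lgen = 0"
  by (auto simp: stab_vec_def lookup_add lookup_single when_def)

text \<open>Write \<open>\<delta> = ad u + \<mu> \<sigma>\<close>, so that \<open>[z, u] = \<mu> h\<^sub>n\<^sub>/\<^sub>2\<close> for the vector \<open>z = d\<^sub>n + h\<^sub>n\<^sub>/\<^sub>2\<close>. The Virasoro
  part of \<open>u\<close> commutes with \<open>d\<^sub>n\<close> modulo the center, so modulo the center it is a multiple of \<open>d\<^sub>n\<close>. Then
  \<open>\<mu>\<close> is a multiple of the coordinate of \<open>u\<close> at \<open>h\<^sub>-\<^sub>n\<^sub>/\<^sub>2\<close>, and the coordinate of \<open>[z, u]\<close> at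
  \<open>\<^bold>l\<close> shows that this is 0. What remains says that \<open>u\<close> is a multiple of \<open>z\<close> modulo the center.\<close>

lemma derivation_killing_stab_vec:
  assumes der: "derivation mhv_scale mhv_bracket \<delta>" and zero: "\<delta> (stab_vec k) = 0"
  shows "\<exists>\<beta>. \<forall>x. \<delta> x = mhv_scale \<beta> (mhv_bracket (stab_vec k) x)"
proof -
  let ?n = "2 * k + 1"
  obtain u \<mu> where E: "\<And>x b. coord (\<delta> x) b
      = coord (mhv_bracket u x) b + \<mu> * h_degree b * coord x b"
    using derivation_inner_plus_h_degree[OF der] by blast
  have Z: "coord (mhv_bracket (stab_vec k) u) b = \<mu> * h_degree b * coord (stab_vec k) b" for b
    using E[of "stab_vec k" b] zero mhv_bracket_antisym[of u "stab_vec k"] by simp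
  have uD: "coord u (Dgen m) = 0" if "m \<noteq> ?n" for m
  proof -
    have "4 * k + 2 - (m + ?n) \<noteq> 0" using that by presburger
    then have "of_int (4 * k + 2 - (m + ?n)) \<noteq> (0 :: complex)" by (simp only: of_int_eq_0_iff not_False_eq_True)
    then show ?thesis using Z[of "Dgen (m + ?n)"]
      unfolding lookup_bracket_stab_vec by (simp del: of_int_diff of_int_add)
  qed
  \<comment> \<open>The coordinate at \<open>\<^bold>l\<close> of \<open>[h\<^sub>n\<^sub>/\<^sub>2, u]\<close>; the index \<open>- n / 2\<close> has the code \<open>- k - 1\<close>.\<close>
  have uH0: "coord u (Hgen (- k - 1)) = 0"
    using Z[of Lgen] by (simp add: lookup_bracket_stab_vec)
  have "?n \<noteq> 0" by presburger
  then have "\<mu> = 0"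
    using Z[of "Hgen k"] uH0 uD[of 0]
    by (simp add: lookup_bracket_stab_vec)
  have uH: "coord u (Hgen j) = (if j = k then coord u (Dgen ?n) else 0)" for j
  proof -
    have "half_index j * coord u (Hgen j) = half_index k * coord u (Dgen (j + k + 1))"
      using Z[of "Hgen (j + ?n)"] \<open>\<mu> = 0\<close>
      by (simp add: lookup_bracket_stab_vec algebra_simps)
    then show ?thesis using uD[of "j + k + 1"] by (auto simp: algebra_simps)
  qed
  have "mhv_bracket u x = mhv_bracket (mhv_scale (coord u (Dgen ?n)) (stab_vec k)) x" for x
    by (rule bracket_left_cong_mod_center)
      (auto simp: uD uH)
  then have "\<delta> x = mhv_scale (coord u (Dgen ?n)) (mhv_bracket (stab_vec k) x)" for x
    using E \<open>\<mu> = 0\<close> by (intro poly_mapping_eqI) (simp add: mhv_bracket_scale_left)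
  then show ?thesis by blast
qed

text \<open>Compare coordinates one step of \<open>ad z\<^sub>n\<close> above the leading term of \<open>x\<close> (in the \<open>d\<^sub>m\<close>, or in the
  \<open>h\<^sub>r\<close> if there is no \<open>d\<^sub>m\<close>): the right-hand side vanishes there, and on the left
  \<open>[d\<^sub>n, d\<^sub>m] = (n - m) d\<^sub>m\<^sub>+\<^sub>n + \<dots>\<close> and \<open>[d\<^sub>n, h\<^sub>r] = - r h\<^sub>n\<^sub>+\<^sub>r\<close> have nonzero coefficients, except for
  \<open>m = n\<close>.\<close>

lemma ad_stab_vec_diagonal_imp_zero:
  assumes "k \<ge> 0"
    and E: "\<And>b. \<beta> * coord (mhv_bracket (stab_vec k) x) b
        = (- \<alpha> * weight b + \<mu> * h_degree b) * coord x b"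
    and top: "\<not> (coord x (Dgen (2 * k + 1)) \<noteq> 0 \<and> (\<forall>m > 2 * k + 1. coord x (Dgen m) = 0))"
  shows "mhv_scale \<beta> (mhv_bracket (stab_vec k) x) = 0"
proof -
  let ?n = "2 * k + 1"
  have max_ex: "\<exists>m. m \<in> S \<and> (\<forall>j > m. j \<notin> S)" if "finite S" "S \<noteq> {}" for S :: "int set"
    using Max_in[OF that] Max_ge[OF that(1)] by (intro exI[of _ "Max S"]) (metis not_less)
  have fin: "finite {i. coord x (f i) \<noteq> 0}" if "inj f" for f :: "int \<Rightarrow> mhv_basis"
    using finite_vimageI[OF finite_keys[of x] that] by (simp add: vimage_def in_keys_iff)
  consider (D) m where "coord x (Dgen m) \<noteq> 0" "\<forall>j > m. coord x (Dgen j) = 0"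
    | (H) j where "\<forall>m. coord x (Dgen m) = 0" "coord x (Hgen j) \<noteq> 0" "\<forall>i > j. coord x (Hgen i) = 0"
    | (Z) "\<forall>m. coord x (Dgen m) = 0" "\<forall>j. coord x (Hgen j) = 0"
    using max_ex[OF fin[of Dgen]] max_ex[OF fin[of Hgen]] by (fastforce simp: inj_def)
  then show ?thesis
  proof cases
    case D
    then have "m \<noteq> ?n" using top by blast
    then have "of_int (4 * k + 2 - (m + ?n)) \<noteq> (0 :: complex)"
      unfolding of_int_eq_0_iff by presburger
    moreover have "coord x (Dgen (m + ?n)) = 0" using D \<open>k \<ge> 0\<close> by auto
    ultimately have "\<beta> = 0" using E[of "Dgen (m + ?n)"] D(1)
      unfolding lookup_bracket_stab_vec by (simp del: of_int_diff of_int_add)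
    then show ?thesis by simp
  next
    case H
    have "coord x (Hgen (j + ?n)) = 0" using H \<open>k \<ge> 0\<close> by auto
    then have "\<beta> = 0" using E[of "Hgen (j + ?n)"] H
      by (simp add: lookup_bracket_stab_vec)
    then show ?thesis by simp
  next
    case Z
    then have "mhv_bracket x (stab_vec k) = mhv_bracket 0 (stab_vec k)"
      by (intro bracket_left_cong_mod_center) auto
    then show ?thesis using mhv_bracket_antisym[of "stab_vec k" x] by simp
  qed
qed

text \<open>2-locality at the pairs \<open>d\<^sub>0, x\<close> and \<open>z\<^sub>n, x\<close> expresses \<open>\<Delta> x - \<delta> x\<close> both as a diagonal operator
  applied to \<open>x\<close> and as a multiple of \<open>[z\<^sub>n, x]\<close>.\<close>

lemma two_local_agrees_off_top_degree:
  assumes loc: "two_local_derivation mhv_scale mhv_bracket \<Delta>"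
    and der: "derivation mhv_scale mhv_bracket \<delta>"
    and d0: "\<delta> (d_vec 0) = \<Delta> (d_vec 0)" and z: "\<delta> (stab_vec k) = \<Delta> (stab_vec k)"
    and "k \<ge> 0"
    and top: "\<not> (coord x (Dgen (2 * k + 1)) \<noteq> 0 \<and> (\<forall>m > 2 * k + 1. coord x (Dgen m) = 0))"
  shows "\<Delta> x = \<delta> x"
proof -
  obtain \<delta>\<^sub>1 where 1: "derivation mhv_scale mhv_bracket \<delta>\<^sub>1" "\<delta>\<^sub>1 (d_vec 0) = \<Delta> (d_vec 0)" "\<delta>\<^sub>1 x = \<Delta> x"
    using loc unfolding two_local_derivation_def by blast
  obtain \<delta>\<^sub>2 where 2: "derivation mhv_scale mhv_bracket \<delta>\<^sub>2" "\<delta>\<^sub>2 (stab_vec k) = \<Delta> (stab_vec k)" "\<delta>\<^sub>2 x = \<Delta> x"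
    using loc unfolding two_local_derivation_def by blast
  obtain \<alpha> \<mu> where A: "\<And>x b. coord (\<delta>\<^sub>1 x - \<delta> x) b
        = (- \<alpha> * weight b + \<mu> * h_degree b) * coord x b"
    using derivation_diagonal[OF derivation_diff[OF 1(1) der]] 1(2) d0 by auto
  obtain \<beta> where B: "\<And>x. \<delta>\<^sub>2 x - \<delta> x = mhv_scale \<beta> (mhv_bracket (stab_vec k) x)"
    using derivation_killing_stab_vec[OF derivation_diff[OF 2(1) der], of k] 2(2) z by auto
  have "mhv_scale \<beta> (mhv_bracket (stab_vec k) x) = 0"
  proof (rule ad_stab_vec_diagonal_imp_zero[OF \<open>k \<ge> 0\<close> _ top])
    show "\<beta> * coord (mhv_bracket (stab_vec k) x) b
        = (- \<alpha> * weight b + \<mu> * h_degree b) * coord x b" for b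
      using A[of x b] B[of x] 1(3) 2(3) by (metis lookup_mhv_scale)
  qed
  then show ?thesis using B[of x] 2(3) by auto
qed

theorem theorem2p5:
  fixes \<Delta> :: "mhv \<Rightarrow> mhv"
  assumes "two_local_derivation mhv_scale mhv_bracket \<Delta>"
  shows "derivation mhv_scale mhv_bracket \<Delta>"
proof -
  obtain \<delta> where der: "derivation mhv_scale mhv_bracket \<delta>"
    and d0: "\<delta> (d_vec 0) = \<Delta> (d_vec 0)" and z1: "\<delta> (stab_vec 0) = \<Delta> (stab_vec 0)"
    using assms unfolding two_local_derivation_def by blast
  note agree = two_local_agrees_off_top_degree[OF assms der d0]
  have z1': "\<delta> (stab_vec 1) = \<Delta> (stab_vec 1)"
    by (rule agree[OF z1, symmetric]) auto
  have "\<Delta> x = \<delta> x" for x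
  proof (cases "coord x (Dgen 1) \<noteq> 0 \<and> (\<forall>m > 1. coord x (Dgen m) = 0)")
    case True
    then show ?thesis by (intro agree[OF z1']) auto
  next
    case False
    then show ?thesis by (intro agree[OF z1]) auto
  qed
  then have "\<Delta> = \<delta>" by (rule ext)
  then show ?thesis using der by simp
qed

end
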